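(* Let $\mathcal{G}=(\mathcal{V},\mathcal{E})$ be a finite undirected graph with $\mathcal{V}=\{1,\dots,N\}$ and neighbor sets $\mathcal{N}_i$, let $f_i:\mathbb{R}^n\to\mathbb{R}\cup\{+\infty\}$, $i\in\mathcal{V}$, be closed, proper and convex, and let $\rho>0$, $\alpha\in(0,1)$. Consider the R-ADMM five-equation recursion (defined in the context) applied to the dual of the consensus problem $$\min_{\mathbf{x},\mathbf{y}}\{f(\mathbf{x})+\iota_{(I-P)}(\mathbf{y})\}\quad\text{s.t.}\quad A\mathbf{x}+\mathbf{y}=0.$$ Then this recursion reduces to alternating between the following two updates: for all $i\in\mathcal{V}$, $$x_i(k)=\arg\min_{x_i\in\mathbb{R}^n}\Big\{f_i(x_i)-\Big(\sum_{j\in\mathcal{N}_i}z_{ji}(k)\Big)^{\top}x_i+\frac{\rho}{2}|\mathcal{N}_i|\,\|x_i\|^2\Big\},$$ and for all $(i,j)\in\mathcal{E}$, \begin{align*} z_{ij}(k+1)&=(1-\alpha)z_{ij}(k)-\alpha z_{ji}(k)+2\alpha\rho x_i(k),\\ z_{ji}(k+1)&=(1-\alpha)z_{ji}(k)-\alpha z_{ij}(k)+2\alpha\rho x_j(k). \end{align*} That is, sequences $(\mathbf{x}(k))_{k\ge0}$, $(\mathbf{z}(k))_{k\ge 0}$ are the $x$- and $z$-components of sequences generated by the five-equation recursion if and only if they satisfy these two updates for all $k\ge0$.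
   Context: The graph has no self-loops, and $\mathcal{N}_i=\{j\in\mathcal{V}:(i,j)\in\mathcal{E}\}$. Write $\mathbf{x}=[x_1^\top,\dots,x_N^\top]^\top$ with $x_i\in\mathbb{R}^n$, and $f(\mathbf{x})=\sum_{i=1}^N f_i(x_i)$. For each undirected edge $(i,j)\in\mathcal{E}$ there are two bridge variables $y_{ij},y_{ji}\in\mathbb{R}^n$; $\mathbf{y}$ stacks all of them. The matrix $A$ is such that the $ij$-block of $A\mathbf{x}$ is $-x_i$ (for every $i$ and $j\in\mathcal{N}_i$), so $A\mathbf{x}+\mathbf{y}=0$ means $y_{ij}=x_i$ and $y_{ji}=x_j$ for each edge. $P$ is the permutation matrix swapping $y_{ij}$ with $y_{ji}$ for each edge, and $\iota_{(I-P)}(\mathbf{y})$ equals $0$ if $(I-P)\mathbf{y}=0$ and $+\infty$ otherwise. The vector $\mathbf{z}$ has the same dimension as $\mathbf{y}$, with blocks $z_{ij},z_{ji}\in\mathbb{R}^n$ for each edge. The R-ADMM five-equation recursion for this problem, started from an arbitrary $\mathbf{z}(0)$, is, for $k=0,1,2,\dots$, \begin{align*} \mathbf{y}(k)&=\arg\min_{\mathbf{y}}\Big\{\iota_{(I-P)}(\mathbf{y})-\mathbf{z}(k)^\top\mathbf{y}+\tfrac{\rho}{2}\|\mathbf{y}\|^2\Big\},\\ \psi(k)&=\mathbf{z}(k)-\rho\,\mathbf{y}(k),\\ \mathbf{x}(k)&=\arg\min_{\mathbf{x}}\Big\{f(\mathbf{x})-(2\psi(k)-\mathbf{z}(k))^\top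 A\mathbf{x}+\tfrac{\rho}{2}\|A\mathbf{x}\|^2\Big\},\\ \xi(k)&=2\psi(k)-\mathbf{z}(k)-\rho A\mathbf{x}(k),\\ \mathbf{z}(k+1)&=\mathbf{z}(k)+2\alpha(\xi(k)-\psi(k)). \end{align*} The convention is that $u=\arg\min_v h(v)$ means that $u$ is a minimizer of $h$. *)

theory Defs
  imports "HOL-Analysis.Analysis"
begin

definition ereal_epigraph :: "('a \<Rightarrow> ereal) \<Rightarrow> ('a \<times> real) set" where
  "ereal_epigraph h = {(v, t). h v \<le> ereal t}"

definition proper_fun :: "('a \<Rightarrow> ereal) \<Rightarrow> bool" where
  "proper_fun h \<longleftrightarrow> (\<forall>v. h v \<noteq> -\<infinity>) \<and> (\<exists>v. h v \<noteq> \<infinity>)"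

definition closed_fun :: "('a::topological_space \<Rightarrow> ereal) \<Rightarrow> bool" where
  "closed_fun h \<longleftrightarrow> closed (ereal_epigraph h)"

definition convex_fun :: "('a::real_vector \<Rightarrow> ereal) \<Rightarrow> bool" where
  "convex_fun h \<longleftrightarrow> convex (ereal_epigraph h)"

abbreviation minimizer :: "('a \<Rightarrow> ereal) \<Rightarrow> 'a \<Rightarrow> bool" where
  "minimizer h u \<equiv> is_arg_min h (\<lambda>_. True) u"

definition undirected_graph :: "'v set \<Rightarrow> ('v \<times> 'v) set \<Rightarrow> bool" where
  "undirected_graph V E \<longleftrightarrow> finite V \<and> E \<subseteq> V \<times> V \<and> sym E \<and> irrefl E"

definition neighbors :: "'v set \<Rightarrow> ('v \<times> 'v) set \<Rightarrow> 'v \<Rightarrow> 'v set" where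
  "neighbors V E i = {j \<in> V. (i, j) \<in> E}"

text \<open>
  A vector stacked from blocks indexed by a finite set \<open>I\<close> is a function on the index type of
  which only the values on \<open>I\<close> are used. The block \<open>y\<^sub>i\<^sub>j\<close> is \<open>y (i, j)\<close>; since \<open>E\<close> is symmetric,
  an undirected edge contributes both \<open>y (i, j)\<close> and \<open>y (j, i)\<close>.
\<close>

definition stack_inner :: "'i set \<Rightarrow> ('i \<Rightarrow> 'a::real_inner) \<Rightarrow> ('i \<Rightarrow> 'a) \<Rightarrow> real" where
  "stack_inner I u v = (\<Sum>i\<in>I. u i \<bullet> v i)"

definition stack_norm :: "'i set \<Rightarrow> ('i \<Rightarrow> 'a::real_normed_vector) \<Rightarrow> real" where
  "stack_norm I u = L2_set (\<lambda>i. norm (u i)) I"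

definition A_op :: "('v \<Rightarrow> 'a::real_vector) \<Rightarrow> ('v \<times> 'v \<Rightarrow> 'a)" where
  "A_op x = (\<lambda>(i, j). - x i)"

definition P_op :: "('v \<times> 'v \<Rightarrow> 'a) \<Rightarrow> ('v \<times> 'v \<Rightarrow> 'a)" where
  "P_op y = (\<lambda>(i, j). y (j, i))"

definition iota_I_minus_P :: "('v \<times> 'v) set \<Rightarrow> ('v \<times> 'v \<Rightarrow> 'a::real_vector) \<Rightarrow> ereal" where
  "iota_I_minus_P E y = (if \<forall>e\<in>E. y e - P_op y e = 0 then 0 else \<infinity>)"

definition radmm_recursion ::
  "'v set \<Rightarrow> ('v \<times> 'v) set \<Rightarrow> ('v \<Rightarrow> 'a::real_inner \<Rightarrow> ereal) \<Rightarrow> real \<Rightarrow> real \<Rightarrow>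
   (nat \<Rightarrow> 'v \<times> 'v \<Rightarrow> 'a) \<Rightarrow> (nat \<Rightarrow> 'v \<times> 'v \<Rightarrow> 'a) \<Rightarrow> (nat \<Rightarrow> 'v \<Rightarrow> 'a) \<Rightarrow>
   (nat \<Rightarrow> 'v \<times> 'v \<Rightarrow> 'a) \<Rightarrow> (nat \<Rightarrow> 'v \<times> 'v \<Rightarrow> 'a) \<Rightarrow> bool" where
  "radmm_recursion V E f \<rho> \<alpha> y \<psi> x \<xi> z \<longleftrightarrow> (\<forall>k.
     minimizer (\<lambda>v. iota_I_minus_P E v - ereal (stack_inner E (z k) v)
                    + ereal (\<rho> / 2 * (stack_norm E v)\<^sup>2)) (y k) \<and>
     (\<forall>e\<in>E. \<psi> k e = z k e - \<rho> *\<^sub>R y k e) \<and>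
     minimizer (\<lambda>w. (\<Sum>i\<in>V. f i (w i))
                    - ereal (stack_inner E (\<lambda>e. 2 *\<^sub>R \<psi> k e - z k e) (A_op w))
                    + ereal (\<rho> / 2 * (stack_norm E (A_op w))\<^sup>2)) (x k) \<and>
     (\<forall>e\<in>E. \<xi> k e = 2 *\<^sub>R \<psi> k e - z k e - \<rho> *\<^sub>R A_op (x k) e) \<and>
     (\<forall>e\<in>E. z (Suc k) e = z k e + (2 * \<alpha>) *\<^sub>R (\<xi> k e - \<psi> k e)))"

end

theory Submission
  imports Defs
begin

text \<open>
  On symmetric stacks \<open>\<langle>z, v\<rangle> = \<langle>P z, v\<rangle>\<close>, so completing the square shows that the
  unique minimizer in the \<open>y\<close>-update is \<open>y = (z + P z) / (2 \<rho>)\<close>. Hence \<open>2 \<psi> - z = - P z\<close>, which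
  turns the objective of the \<open>x\<close>-update into a sum of functions of the single blocks \<open>x\<^sub>i\<close>, and
  \<open>\<xi> - \<psi> = \<rho> x\<^sub>i - (z + P z) / 2\<close> on the block \<open>(i, j)\<close>.
\<close>

lemma minimizer_iff_le: "minimizer h u \<longleftrightarrow> (\<forall>v. h u \<le> h v)"
  by (auto simp: is_arg_min_linorder)

text \<open>Properness makes the optimal value of the sum finite, so that a summand can be cancelled.\<close>

lemma minimizer_separable_sum:
  fixes g :: "'i \<Rightarrow> 'a \<Rightarrow> ereal"
  assumes "finite I" and proper: "\<And>i. i \<in> I \<Longrightarrow> proper_fun (g i)"
  shows "minimizer (\<lambda>w. \<Sum>i\<in>I. g i (w i)) x \<longleftrightarrow> (\<forall>i\<in>I. minimizer (g i) (x i))"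
proof
  assume "\<forall>i\<in>I. minimizer (g i) (x i)"
  then show "minimizer (\<lambda>w. \<Sum>i\<in>I. g i (w i)) x"
    by (auto simp: minimizer_iff_le intro!: sum_mono)
next
  assume "minimizer (\<lambda>w. \<Sum>i\<in>I. g i (w i)) x"
  then have min: "(\<Sum>i\<in>I. g i (x i)) \<le> (\<Sum>i\<in>I. g i (w i))" for w
    by (auto simp: minimizer_iff_le)
  have not_minf: "g i v \<noteq> -\<infinity>" if "i \<in> I" for i v
    using proper[OF that] by (auto simp: proper_fun_def)
  \<comment> \<open>A stack whose blocks all have values below \<infinity> keeps the optimal sum
    below \<infinity>, so no summand at \<open>x\<close> is infinite.\<close>
  obtain w where w: "\<And>i. i \<in> I \<Longrightarrow> g i (w i) \<noteq> \<infinity>"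
    using proper unfolding proper_fun_def by metis
  have "(\<Sum>i\<in>I. g i (w i)) \<noteq> \<infinity>"
    using w by (simp add: sum_Pinfty)
  then have "(\<Sum>i\<in>I. g i (x i)) \<noteq> \<infinity>"
    using min[of w] by auto
  then have not_inf: "g i (x i) \<noteq> \<infinity>" if "i \<in> I" for i
    using that \<open>finite I\<close> by (auto simp: sum_Pinfty)
  show "\<forall>i\<in>I. minimizer (g i) (x i)"
    unfolding minimizer_iff_le
  proof (intro ballI allI)
    fix i v assume i: "i \<in> I"
    \<comment> \<open>Testing against \<open>x(i := v)\<close> changes block \<open>i\<close> alone;
      the sum over the other blocks is finite and cancels from both sides.\<close>
    let ?rest = "\<Sum>j\<in>I - {i}. g j (x j)"
    have "\<bar>?rest\<bar> \<noteq> \<infinity>"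
      using not_inf not_minf by (auto simp: sum_Inf)
    moreover have "(\<Sum>j\<in>I. g j (x j)) = g i (x i) + ?rest"
      using i \<open>finite I\<close> by (simp add: sum.remove)
    moreover have "(\<Sum>j\<in>I. g j ((x(i := v)) j)) = g i v + ?rest"
      using i \<open>finite I\<close> by (simp add: sum.remove)
    ultimately show "g i (x i) \<le> g i v"
      using min[of "x(i := v)"] by (cases ?rest; cases "g i v"; cases "g i (x i)"; force)
  qed
qed

lemma stack_norm_power2: "(stack_norm I u)\<^sup>2 = (\<Sum>i\<in>I. (norm (u i))\<^sup>2)"
  by (simp add: stack_norm_def L2_set_def sum_nonneg)

text \<open>The objective reads a stack only on \<open>E\<close>, so uniqueness of the minimizer can
  hold only there; hence the quantifier over edges.\<close>

lemma minimizer_y_update_iff: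
  fixes z y :: "'v \<times> 'v \<Rightarrow> 'a::real_inner"
  assumes "finite E" and "sym E" and "\<rho> > 0"
  shows "minimizer (\<lambda>v. iota_I_minus_P E v - ereal (stack_inner E z v)
           + ereal (\<rho> / 2 * (stack_norm E v)\<^sup>2)) y
         \<longleftrightarrow> (\<forall>e\<in>E. y e = (1 / (2 * \<rho>)) *\<^sub>R (z e + P_op z e))"
proof -
  \<comment> \<open>\<open>c\<close> is the vertex of the completed square, and \<open>- K\<close>
    turns out to be the optimal value.\<close>
  define c where "c e = (1 / (2 * \<rho>)) *\<^sub>R (z e + P_op z e)" for e
  define J where "J v = iota_I_minus_P E v - ereal (stack_inner E z v)
    + ereal (\<rho> / 2 * (stack_norm E v)\<^sup>2)" for v
  define K where "K = \<rho> / 2 * (\<Sum>e\<in>E. (norm (c e))\<^sup>2)"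
  define symm where "symm v \<longleftrightarrow> (\<forall>e\<in>E. v e = P_op v e)" for v :: "'v \<times> 'v \<Rightarrow> 'a"
  have J_infinite: "J v = \<infinity>" if "\<not> symm v" for v
    using that by (auto simp: J_def symm_def iota_I_minus_P_def)
  have J_finite: "J v = ereal (\<rho> / 2 * (\<Sum>e\<in>E. (norm (v e - c e))\<^sup>2) - K)" if "symm v" for v
  proof -
    \<comment> \<open>Edge reversal permutes \<open>E\<close>. Since \<open>v\<close> is fixed by
      it, \<open>z\<close> can be replaced by its average with \<open>P_op z\<close>, which is
      \<open>\<rho>\<close> times \<open>c\<close>.\<close>
    have "(\<Sum>e\<in>E. z e \<bullet> v e) = (\<Sum>e\<in>E. P_op z e \<bullet> P_op v e)"
      by (rule sum.reindex_bij_witness[of _ prod.swap prod.swap])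
         (use \<open>sym E\<close> in \<open>auto simp: P_op_def dest: symD\<close>)
    also have "\<dots> = (\<Sum>e\<in>E. P_op z e \<bullet> v e)"
      using that by (intro sum.cong) (auto simp: symm_def)
    finally have "(\<Sum>e\<in>E. z e \<bullet> v e) = (\<Sum>e\<in>E. ((z e + P_op z e) \<bullet> v e) / 2)"
      by (simp add: inner_add_left sum.distrib flip: sum_divide_distrib)
    also have "\<dots> = (\<Sum>e\<in>E. \<rho> * (c e \<bullet> v e))"
      using \<open>\<rho> > 0\<close> by (simp add: c_def)
    finally have inner: "stack_inner E z v = (\<Sum>e\<in>E. \<rho> * (c e \<bullet> v e))"
      by (simp add: stack_inner_def)
    have "(norm (v e - c e))\<^sup>2 = (norm (v e))\<^sup>2 - 2 * (c e \<bullet> v e) + (norm (c e))\<^sup>2" for e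
      by (simp add: power2_norm_eq_inner inner_diff_left inner_diff_right inner_commute)
    then have expand: "(\<Sum>e\<in>E. (norm (v e - c e))\<^sup>2)
      = (\<Sum>e\<in>E. (norm (v e))\<^sup>2) - 2 * (\<Sum>e\<in>E. c e \<bullet> v e) + (\<Sum>e\<in>E. (norm (c e))\<^sup>2)"
      by (simp only: sum.distrib sum_subtractf sum_distrib_left)
    have "\<rho> / 2 * (\<Sum>e\<in>E. (norm (v e - c e))\<^sup>2) - K
      = - stack_inner E z v + \<rho> / 2 * (stack_norm E v)\<^sup>2"
      unfolding expand K_def inner stack_norm_power2 sum_distrib_left[symmetric]
      by (simp add: algebra_simps)
    moreover have "iota_I_minus_P E v = 0"
      using that by (auto simp: symm_def iota_I_minus_P_def)
    ultimately show ?thesis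
      by (simp add: J_def zero_ereal_def)
  qed
  have symm_c: "symm c"
    by (auto simp: symm_def c_def P_op_def add.commute)
  have J_c: "J c = ereal (- K)"
    by (simp add: J_finite symm_c)
  have "minimizer J y \<longleftrightarrow> (\<forall>e\<in>E. y e = c e)"
  proof
    assume "minimizer J y"
    \<comment> \<open>Comparison with the feasible stack \<open>c\<close>: a finite value forces
      symmetry, and then the squared distance to \<open>c\<close> has to vanish.\<close>
    then have le: "J y \<le> ereal (- K)"
      using J_c by (auto simp: minimizer_iff_le dest: spec[of _ c])
    then have "symm y"
      using J_infinite by fastforce
    then have "\<rho> * (\<Sum>e\<in>E. (norm (y e - c e))\<^sup>2) \<le> 0"
      using le by (simp add: J_finite)
    then have "(\<Sum>e\<in>E. (norm (y e - c e))\<^sup>2) = 0"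
      using \<open>\<rho> > 0\<close> by (simp add: mult_le_0_iff antisym sum_nonneg)
    then show "\<forall>e\<in>E. y e = c e"
      using \<open>finite E\<close> by (simp add: sum_nonneg_eq_0_iff)
  next
    assume y: "\<forall>e\<in>E. y e = c e"
    \<comment> \<open>Agreement with \<open>c\<close> is known only on \<open>E\<close>, while
      \<open>P_op y e\<close> reads the reversed edge; symmetry of \<open>E\<close> closes this
      gap.\<close>
    have "symm y"
      unfolding symm_def
    proof
      fix e assume "e \<in> E"
      moreover from this have "prod.swap e \<in> E"
        using \<open>sym E\<close> by (cases e) (simp add: symD)
      ultimately have "y e = c e" "y (prod.swap e) = c (prod.swap e)" "c e = P_op c e"
        using y symm_c by (simp_all only: symm_def)
      then show "y e = P_op y e"
        by (cases e) (simp add: P_op_def)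
    qed
    then have "J y = ereal (- K)"
      using y by (simp add: J_finite)
    moreover have "ereal (- K) \<le> J v" for v
      using \<open>\<rho> > 0\<close> J_finite[of v] J_infinite[of v]
      by (cases "symm v") (auto intro!: mult_nonneg_nonneg sum_nonneg)
    ultimately show "minimizer J y"
      by (simp add: minimizer_iff_le)
  qed
  then show ?thesis
    unfolding J_def[abs_def] c_def .
qed

text \<open>Groups ordered edges by their first endpoint, the one whose block \<open>A_op\<close>
  reads; \<open>E\<close> is the dependent product of \<open>V\<close> and the neighbor
  sets.\<close>

lemma sum_edges_eq_sum_neighbors:
  assumes "undirected_graph V E"
  shows "(\<Sum>e\<in>E. h e) = (\<Sum>i\<in>V. \<Sum>j\<in>neighbors V E i. h (i, j))"
proof -
  have "E = Sigma V (neighbors V E)"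
    using assms by (auto simp: undirected_graph_def neighbors_def)
  moreover have "finite V" "\<forall>i\<in>V. finite (neighbors V E i)"
    using assms by (auto simp: undirected_graph_def neighbors_def)
  ultimately show ?thesis
    by (simp add: sum.Sigma)
qed

text \<open>Because \<open>s\<close> and \<open>t\<close> are real, the regrouping is sound even for
  infinite \<open>a\<close>, so it applies to the extended-valued objectives.\<close>

lemma ereal_diff_add_eq: "a - ereal s + ereal t = a + ereal (t - s)"
  by (cases a) auto

lemma proper_fun_add_ereal:
  assumes "proper_fun h"
  shows "proper_fun (\<lambda>v. h v + ereal (q v))"
  using assms by (auto simp: proper_fun_def)

lemma minimizer_x_update_iff:
  fixes f :: "'v \<Rightarrow> 'a::real_inner \<Rightarrow> ereal"
  assumes graph: "undirected_graph V E"
    and proper: "\<And>i. i \<in> V \<Longrightarrow> proper_fun (f i)"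
    and u: "\<And>e. e \<in> E \<Longrightarrow> u e = - P_op z e"
  shows "minimizer (\<lambda>w. (\<Sum>i\<in>V. f i (w i)) - ereal (stack_inner E u (A_op w))
           + ereal (\<rho> / 2 * (stack_norm E (A_op w))\<^sup>2)) x
    \<longleftrightarrow> (\<forall>i\<in>V. minimizer (\<lambda>v. f i v - ereal ((\<Sum>j\<in>neighbors V E i. z (j, i)) \<bullet> v)
           + ereal (\<rho> / 2 * real (card (neighbors V E i)) * (norm v)\<^sup>2)) (x i))"
proof -
  \<comment> \<open>\<open>q i\<close> collects the real-valued terms attached to block
    \<open>i\<close>; adding it to \<open>f i\<close> preserves properness, as the separation lemma
    requires.\<close>
  define q where "q i v = \<rho> / 2 * real (card (neighbors V E i)) * (norm v)\<^sup>2
    - (\<Sum>j\<in>neighbors V E i. z (j, i)) \<bullet> v" for i v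
  \<comment> \<open>The minus sign of \<open>u\<close> cancels the one in
    \<open>A_op\<close>.\<close>
  have "stack_inner E u (A_op w) = (\<Sum>e\<in>E. P_op z e \<bullet> w (fst e))" for w
    unfolding stack_inner_def by (intro sum.cong) (auto simp: u A_op_def)
  then have inner: "stack_inner E u (A_op w)
    = (\<Sum>i\<in>V. (\<Sum>j\<in>neighbors V E i. z (j, i)) \<bullet> w i)" for w
    by (simp add: sum_edges_eq_sum_neighbors[OF graph] P_op_def inner_sum_left)
  \<comment> \<open>The block of \<open>i\<close> occurs in \<open>A_op w\<close> once per neighbor,
    whence the cardinality factor.\<close>
  have norm: "(stack_norm E (A_op w))\<^sup>2
    = (\<Sum>i\<in>V. real (card (neighbors V E i)) * (norm (w i))\<^sup>2)" for w :: "'v \<Rightarrow> 'a"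
    by (simp add: stack_norm_power2 sum_edges_eq_sum_neighbors[OF graph] A_op_def)
  have "(\<Sum>i\<in>V. f i (w i)) - ereal (stack_inner E u (A_op w))
      + ereal (\<rho> / 2 * (stack_norm E (A_op w))\<^sup>2)
    = (\<Sum>i\<in>V. f i (w i) + ereal (q i (w i)))" for w
    by (simp add: ereal_diff_add_eq inner norm q_def sum.distrib sum_subtractf sum_distrib_left
        mult.assoc)
  moreover have "f i v - ereal ((\<Sum>j\<in>neighbors V E i. z (j, i)) \<bullet> v)
      + ereal (\<rho> / 2 * real (card (neighbors V E i)) * (norm v)\<^sup>2)
    = f i v + ereal (q i v)" for i v
    by (simp add: ereal_diff_add_eq q_def)
  moreover have "minimizer (\<lambda>w. \<Sum>i\<in>V. f i (w i) + ereal (q i (w i))) x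
    \<longleftrightarrow> (\<forall>i\<in>V. minimizer (\<lambda>v. f i v + ereal (q i v)) (x i))"
    using graph proper
    by (intro minimizer_separable_sum) (auto simp: undirected_graph_def proper_fun_add_ereal)
  ultimately show ?thesis
    by (simp only:)
qed

text \<open>Matches the single z-equation per ordered edge in the recursion with the pair of
  equations per edge in the reduced form.\<close>

lemma ball_sym_iff:
  assumes "sym E"
  shows "(\<forall>e\<in>E. Q e) \<longleftrightarrow> (\<forall>(i, j)\<in>E. Q (i, j) \<and> Q (j, i))"
  using assms by (auto dest: symD)

theorem proposition1:
  fixes N :: nat
    and V :: "nat set"
    and E :: "(nat \<times> nat) set"
    and f :: "nat \<Rightarrow> real ^ 'n \<Rightarrow> ereal"
    and \<rho> \<alpha> :: real
    and x :: "nat \<Rightarrow> nat \<Rightarrow> real ^ 'n"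
    and z :: "nat \<Rightarrow> nat \<times> nat \<Rightarrow> real ^ 'n"
  assumes "V = {1..N}"
    and "undirected_graph V E"
    and "\<And>i. i \<in> V \<Longrightarrow> closed_fun (f i) \<and> proper_fun (f i) \<and> convex_fun (f i)"
    and "\<rho> > 0"
    and "0 < \<alpha>" and "\<alpha> < 1"
  shows "(\<exists>y \<psi> \<xi>. radmm_recursion V E f \<rho> \<alpha> y \<psi> x \<xi> z) \<longleftrightarrow>
    (\<forall>k.
      (\<forall>i\<in>V. minimizer (\<lambda>v. f i v - ereal ((\<Sum>j\<in>neighbors V E i. z k (j, i)) \<bullet> v)
                + ereal (\<rho> / 2 * real (card (neighbors V E i)) * (norm v)\<^sup>2)) (x k i)) \<and>
      (\<forall>(i, j)\<in>E.
        z (Suc k) (i, j) = (1 - \<alpha>) *\<^sub>R z k (i, j) - \<alpha> *\<^sub>R z k (j, i) + (2 * \<alpha> * \<rho>) *\<^sub>R x k i \<and>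
        z (Suc k) (j, i) = (1 - \<alpha>) *\<^sub>R z k (j, i) - \<alpha> *\<^sub>R z k (i, j) + (2 * \<alpha> * \<rho>) *\<^sub>R x k j))"
proof -
  note graph = \<open>undirected_graph V E\<close>
  have "finite E" "sym E"
    using graph finite_subset[of E "V \<times> V"] by (auto simp: undirected_graph_def)
  note y_iff = minimizer_y_update_iff[OF this \<open>\<rho> > 0\<close>]
  have proper: "proper_fun (f i)" if "i \<in> V" for i
    using assms(3)[OF that] by blast
  \<comment> \<open>Canonical auxiliary sequences: \<open>x\<close> and \<open>z\<close> determine
    them on \<open>E\<close>, and the same formulas are used off \<open>E\<close>.\<close>
  define y where "y k e = (1 / (2 * \<rho>)) *\<^sub>R (z k e + P_op (z k) e)" for k e
  define \<psi> where "\<psi> k e = z k e - \<rho> *\<^sub>R y k e" for k e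
  define \<xi> where "\<xi> k e = 2 *\<^sub>R \<psi> k e - z k e - \<rho> *\<^sub>R A_op (x k) e" for k e
  have \<psi>: "\<psi> k e = (1 / 2) *\<^sub>R (z k e - P_op (z k) e)" for k e
  proof -
    have "\<psi> k e = z k e - (1 / 2) *\<^sub>R (z k e + P_op (z k) e)"
      using \<open>\<rho> > 0\<close> by (simp add: \<psi>_def y_def)
    then show ?thesis
      by (simp add: vec_eq_iff field_simps)
  qed
  have u: "2 *\<^sub>R \<psi> k e - z k e = - P_op (z k) e" for k e
    by (simp add: \<psi>)
  have x_iff: "minimizer (\<lambda>w. (\<Sum>i\<in>V. f i (w i))
        - ereal (stack_inner E (\<lambda>e. 2 *\<^sub>R \<psi> k e - z k e) (A_op w))
        + ereal (\<rho> / 2 * (stack_norm E (A_op w))\<^sup>2)) (x k)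
    \<longleftrightarrow> (\<forall>i\<in>V. minimizer (\<lambda>v. f i v - ereal ((\<Sum>j\<in>neighbors V E i. z k (j, i)) \<bullet> v)
        + ereal (\<rho> / 2 * real (card (neighbors V E i)) * (norm v)\<^sup>2)) (x k i))" for k
    by (rule minimizer_x_update_iff[OF graph proper u])
  have z_step: "z k (i, j) + (2 * \<alpha>) *\<^sub>R (\<xi> k (i, j) - \<psi> k (i, j))
    = (1 - \<alpha>) *\<^sub>R z k (i, j) - \<alpha> *\<^sub>R z k (j, i) + (2 * \<alpha> * \<rho>) *\<^sub>R x k i" for k i j
    \<comment> \<open>The first call replaces \<open>2 *\<^sub>R \<psi> k e - z k e\<close> as a
      whole by \<open>- P_op (z k) e\<close>; the remaining \<open>\<psi>\<close> is expanded
      afterwards.\<close>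
    by (simp add: \<xi>_def u) (simp add: \<psi> P_op_def A_op_def vec_eq_iff field_simps)
  have z_update_iff: "(\<forall>e\<in>E. z (Suc k) e = z k e + (2 * \<alpha>) *\<^sub>R (\<xi> k e - \<psi> k e)) \<longleftrightarrow>
      (\<forall>(i, j)\<in>E.
        z (Suc k) (i, j) = (1 - \<alpha>) *\<^sub>R z k (i, j) - \<alpha> *\<^sub>R z k (j, i) + (2 * \<alpha> * \<rho>) *\<^sub>R x k i \<and>
        z (Suc k) (j, i) = (1 - \<alpha>) *\<^sub>R z k (j, i) - \<alpha> *\<^sub>R z k (i, j) + (2 * \<alpha> * \<rho>) *\<^sub>R x k j)"
    for k
    unfolding z_step[symmetric] by (rule ball_sym_iff[OF \<open>sym E\<close>])
  \<comment> \<open>The existential is removed by showing that any witnesses agree on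
    \<open>E\<close> with the canonical ones.\<close>
  have "(\<exists>y' \<psi>' \<xi>'. radmm_recursion V E f \<rho> \<alpha> y' \<psi>' x \<xi>' z)
    \<longleftrightarrow> radmm_recursion V E f \<rho> \<alpha> y \<psi> x \<xi> z"
  proof
    assume "\<exists>y' \<psi>' \<xi>'. radmm_recursion V E f \<rho> \<alpha> y' \<psi>' x \<xi>' z"
    then obtain y' \<psi>' \<xi>' where rec: "radmm_recursion V E f \<rho> \<alpha> y' \<psi>' x \<xi>' z"
      by blast
    \<comment> \<open>Uniqueness of the y-minimizer on \<open>E\<close> enters here; the equations
      for \<open>\<psi>'\<close> and \<open>\<xi>'\<close> then propagate the agreement.\<close>
    have y': "\<forall>e\<in>E. y' k e = y k e" for k
      using rec unfolding radmm_recursion_def y_iff y_def by blast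
    have "\<forall>e\<in>E. \<psi>' k e = z k e - \<rho> *\<^sub>R y' k e" for k
      using rec unfolding radmm_recursion_def by blast
    with y' have \<psi>': "\<forall>e\<in>E. \<psi>' k e = \<psi> k e" for k
      by (simp add: \<psi>_def)
    have "\<forall>e\<in>E. \<xi>' k e = 2 *\<^sub>R \<psi>' k e - z k e - \<rho> *\<^sub>R A_op (x k) e" for k
      using rec unfolding radmm_recursion_def by blast
    with \<psi>' have \<xi>': "\<forall>e\<in>E. \<xi>' k e = \<xi> k e" for k
      by (simp add: \<xi>_def)
    have "\<forall>e\<in>E. z (Suc k) e = z k e + (2 * \<alpha>) *\<^sub>R (\<xi>' k e - \<psi>' k e)" for k
      using rec unfolding radmm_recursion_def by blast
    with \<psi>' \<xi>' have z_Suc: "\<forall>e\<in>E. z (Suc k) e = z k e + (2 * \<alpha>) *\<^sub>R (\<xi> k e - \<psi> k e)" for k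
      by simp
    \<comment> \<open>Agreement on \<open>E\<close> suffices to make the two x-objectives equal as
      functions, so their minimizers coincide.\<close>
    have inner: "stack_inner E (\<lambda>e. 2 *\<^sub>R \<psi>' k e - z k e) v
      = stack_inner E (\<lambda>e. 2 *\<^sub>R \<psi> k e - z k e) v" for k v
      using \<psi>' by (simp add: stack_inner_def)
    show "radmm_recursion V E f \<rho> \<alpha> y \<psi> x \<xi> z"
      unfolding radmm_recursion_def y_iff
    proof (intro allI conjI)
      fix k
      show "minimizer (\<lambda>w. (\<Sum>i\<in>V. f i (w i))
          - ereal (stack_inner E (\<lambda>e. 2 *\<^sub>R \<psi> k e - z k e) (A_op w))
          + ereal (\<rho> / 2 * (stack_norm E (A_op w))\<^sup>2)) (x k)"
        using rec unfolding radmm_recursion_def inner by blast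
      show "\<forall>e\<in>E. z (Suc k) e = z k e + (2 * \<alpha>) *\<^sub>R (\<xi> k e - \<psi> k e)"
        by (rule z_Suc)
    qed (simp_all add: y_def \<psi>_def \<xi>_def)
  qed blast
  also have "\<dots> \<longleftrightarrow> (\<forall>k.
      (\<forall>i\<in>V. minimizer (\<lambda>v. f i v - ereal ((\<Sum>j\<in>neighbors V E i. z k (j, i)) \<bullet> v)
                + ereal (\<rho> / 2 * real (card (neighbors V E i)) * (norm v)\<^sup>2)) (x k i)) \<and>
      (\<forall>e\<in>E. z (Suc k) e = z k e + (2 * \<alpha>) *\<^sub>R (\<xi> k e - \<psi> k e)))"
    unfolding radmm_recursion_def y_iff x_iff
    \<comment> \<open>For the canonical sequences the y-, \<open>\<psi>\<close>- and
      \<open>\<xi>\<close>-conditions become reflexive equations and drop out, leaving the x- and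
      z-updates.\<close>
    by (simp only: y_def[symmetric] \<psi>_def[symmetric] \<xi>_def[symmetric] simp_thms ball_triv)
  finally show ?thesis
    unfolding z_update_iff .
qed

end
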